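(* Let $n\ge 2$ be an integer with a partition $n=\sum_{k=1}^{\tau} n_k$, where $n_k\ge 1$ are integers and $n_k\ge m_k:=\sum_{i=k+1}^{\tau} n_i$ for all $k\in[\tau-1]$. Let $A_{\mathrm{RHB}}\in\mathbb{R}^{n\times n}$ be the matrix generated by the RHB factorization algorithm (described in the context) and $\{A^{(k)}\}_{k=1}^{\tau}$ its associated sequence. Then $A_{\mathrm{RHB}}$ is hierarchically banded, satisfies $$J=J_0A_{\mathrm{RHB}}J_0,$$ and satisfies, for all $k\in[\tau-1]$: (i) the diagonal entry $A^{(k)}_{12}[j,j]$ is nonzero for $j\in\{1,\ 1+n_{k+1},\ 1+n_{k+1}+n_{k+2},\ \ldots,\ 1+\sum_{\ell=1}^{\tau-k-1}n_{k+\ell}\}$, and all other diagonal entries of $A^{(k)}_{12}$ are zero; (ii) $A^{(k)}_{11}=\operatorname{diag}(\alpha_k,1,\ldots,1)$ for some $\alpha_k\in\mathbb{R}$. In addition, the total number of nonzeros is $\operatorname{nnz}(A_{\mathrm{RHB}})=n+\tau(\tau-1)$, and the largest node degree is $d_{\max}(A_{\mathrm{RHB}})=\tau$.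
   Context: Notation: $[r]=\{1,\ldots,r\}$. $\mathbf{1}_r$ is the all-ones column vector in $\mathbb{R}^r$. $J=\frac1n\mathbf{1}_n\mathbf{1}_n^{\mathsf T}$, $J_k=\frac1{n_k}\mathbf{1}_{n_k}\mathbf{1}_{n_k}^{\mathsf T}\in\mathbb{R}^{n_k\times n_k}$, and $J_0=J_1\oplus\cdots\oplus J_\tau$, where $\oplus$ is the direct sum (block diagonal matrix). Put $m_0:=n$ (so $m_{\tau-1}=n_\tau$). $\operatorname{nnz}(A)$ is the number of nonzero entries of $A$, and $d_{\max}(A)=\max_i \operatorname{nnz}(A_{i,:})$, where $A_{i,:}$ is the $i$th row. Hierarchically banded (HB) matrices: given the partition of $n$, a real symmetric $n\times n$ matrix $A$ is hierarchically banded if there are symmetric matrices $A^{(k)}\in\mathbb{R}^{m_{k-1}\times m_{k-1}}$, $k\in[\tau]$ (the HB sequence of $A$), such that $A^{(1)}=A$, $A^{(\tau)}$ is a diagonal $n_\tau\times n_\tau$ matrix, and for all $k\in[\tau-1]$ $$A^{(k)}=\begin{bmatrix}A^{(k)}_{11}&A^{(k)}_{12}\\ (A^{(k)}_{12})^{\mathsf T}&A^{(k)}_{22}\end{bmatrix},$$ where $A^{(k)}_{11}$ is an $n_k\times n_k$ diagonal matrix, $A^{(k)}_{12}\in\mathbb{R}^{n_k\times m_k}$ has nonzero entries only on its diagonal (positions $[j,j]$), and $A^{(k)}_{22}=A^{(k+1)}$. RHB (reduced hierarchically banded) factorization algorithm: given the partition, it outputs $A_{\mathrm{RHB}}:=A^{(1)}$,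 where the $A^{(k)}$ are given recursively as follows. $A^{(\tau)}=\operatorname{diag}\big(\frac{n_\tau^2}{n}-n_\tau+1,1,\ldots,1\big)\in\mathbb{R}^{n_\tau\times n_\tau}$. For $k\in[\tau-1]$, $$A^{(k)}=\begin{bmatrix}A^{(k)}_{11}&A^{(k)}_{12}\\ (A^{(k)}_{12})^{\mathsf T}&A^{(k)}_{22}\end{bmatrix}$$ with $A^{(k)}_{22}=A^{(k+1)}$, $$A^{(k)}_{11}=\operatorname{diag}\Big(\tfrac{n_k^2}{n}-n_k+1,1,\ldots,1\Big)\in\mathbb{R}^{n_k\times n_k},$$ and $A^{(k)}_{12}\in\mathbb{R}^{n_k\times m_k}$ with entries $A^{(k)}_{12}[i,j]=\frac{n_kn_{k+\ell+1}}{n}$ if $i=j=1+\sum_{r=1}^{\ell}n_{k+r}$ for some $\ell\in\{0,1,\ldots,\tau-k-1\}$ (the empty sum being $0$), and $A^{(k)}_{12}[i,j]=0$ otherwise.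
   Formalization: The nnz formula is claimed except when n=4 and n_1=2, and the d_max formula except for the partition 4=2+2; there a first diagonal entry is 0 and the claims fail (2+2: nnz=4, d_max=1; 2+1+1: nnz=9). *)

theory Defs
  imports Complex_Main "Jordan_Normal_Form.Matrix"
begin

(* A partition n = n_1 + ... + n_tau is given by tau and a function p with p k = n_k for
   k = 1, ..., tau; values of p outside this range are never used. Blocks are numbered from 1,
   but matrix rows and columns are numbered from 0, following Jordan_Normal_Form. *)

(* m_k; in particular m_0 = n and m_{tau-1} = n_tau. *)
definition tail_size :: "(nat \<Rightarrow> nat) \<Rightarrow> nat \<Rightarrow> nat \<Rightarrow> nat" where
  "tail_size p \<tau> k = (\<Sum>i = k + 1..\<tau>. p i)"

definition averaging_mat :: "nat \<Rightarrow> real mat" where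
  "averaging_mat n = mat n n (\<lambda>_. 1 / real n)"

definition block_averaging_mat :: "(nat \<Rightarrow> nat) \<Rightarrow> nat \<Rightarrow> real mat" where
  "block_averaging_mat p \<tau> = diag_block_mat (map (\<lambda>k. averaging_mat (p k)) [1..<\<tau> + 1])"

definition nnz :: "real mat \<Rightarrow> nat" where
  "nnz A = card {(i, j). i < dim_row A \<and> j < dim_col A \<and> A $$ (i, j) \<noteq> 0}"

definition d_max :: "real mat \<Rightarrow> nat" where
  "d_max A = Max ((\<lambda>i. card {j. j < dim_col A \<and> A $$ (i, j) \<noteq> 0}) ` {..<dim_row A})"

(* The library's diagonal_mat does not require a square matrix: it says that all entries off
   the positions (j,j) vanish. So it also expresses the condition on the n_k x m_k block A12. *)
definition hb_sequence ::
  "(nat \<Rightarrow> nat) \<Rightarrow> nat \<Rightarrow> real mat \<Rightarrow> (nat \<Rightarrow> real mat) \<Rightarrow> bool" where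
  "hb_sequence p \<tau> A As \<longleftrightarrow>
     (\<forall>k\<in>{1..\<tau>}. As k \<in> carrier_mat (tail_size p \<tau> (k - 1)) (tail_size p \<tau> (k - 1)) \<and>
                transpose_mat (As k) = As k) \<and>
     As 1 = A \<and> diagonal_mat (As \<tau>) \<and>
     (\<forall>k\<in>{1..<\<tau>}. \<exists>A11 A12.
        A11 \<in> carrier_mat (p k) (p k) \<and> diagonal_mat A11 \<and>
        A12 \<in> carrier_mat (p k) (tail_size p \<tau> k) \<and> diagonal_mat A12 \<and>
        As k = four_block_mat A11 A12 (transpose_mat A12) (As (k + 1)))"

definition hierarchically_banded :: "(nat \<Rightarrow> nat) \<Rightarrow> nat \<Rightarrow> real mat \<Rightarrow> bool" where
  "hierarchically_banded p \<tau> A \<longleftrightarrow> (\<exists>As. hb_sequence p \<tau> A As)"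

(* The sum n_{k+1} + ... + n_{k+l}: the 0-based position, inside the trailing part
   n_{k+1} + ... + n_tau, at which block k+l+1 starts. *)
definition offset :: "(nat \<Rightarrow> nat) \<Rightarrow> nat \<Rightarrow> nat \<Rightarrow> nat" where
  "offset p k l = (\<Sum>r = 1..l. p (k + r))"

(* The first diagonal entry vanishes exactly when n = 4 and n_k = 2, and only then does the
   nonzero pattern differ from the generic one. For the partition 4 = 2 + 2 this gives
   nnz = 4 and d_max = 1, for 4 = 2 + 1 + 1 it gives nnz = 9 and d_max = 3. *)
definition rhb_11 :: "(nat \<Rightarrow> nat) \<Rightarrow> nat \<Rightarrow> nat \<Rightarrow> real mat" where
  "rhb_11 p \<tau> k = mat_diag (p k)
     (\<lambda>i. if i = 0 then (real (p k))\<^sup>2 / real (tail_size p \<tau> 0) - real (p k) + 1 else 1)"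

(* The l is unique when the p k are positive, because the offsets are then distinct. *)
definition rhb_12 :: "(nat \<Rightarrow> nat) \<Rightarrow> nat \<Rightarrow> nat \<Rightarrow> real mat" where
  "rhb_12 p \<tau> k = mat (p k) (tail_size p \<tau> k)
     (\<lambda>(i, j). if \<exists>l<\<tau> - k. i = offset p k l \<and> j = offset p k l
       then real (p k) * real (p (k + (THE l. l < \<tau> - k \<and> j = offset p k l) + 1))
              / real (tail_size p \<tau> 0)
       else 0)"

function rhb_seq :: "(nat \<Rightarrow> nat) \<Rightarrow> nat \<Rightarrow> nat \<Rightarrow> real mat" where
  "rhb_seq p \<tau> k =
     (if k < \<tau>
      then four_block_mat (rhb_11 p \<tau> k) (rhb_12 p \<tau> k)
             (transpose_mat (rhb_12 p \<tau> k)) (rhb_seq p \<tau> (k + 1))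
      else rhb_11 p \<tau> k)"
  by pat_completeness auto
termination by (relation "measure (\<lambda>(p, \<tau>, k). \<tau> - k)") auto

declare rhb_seq.simps [simp del]

definition rhb_mat :: "(nat \<Rightarrow> nat) \<Rightarrow> nat \<Rightarrow> real mat" where
  "rhb_mat p \<tau> = rhb_seq p \<tau> 1"

end

(* Up to symmetry, two different blocks k < k' of the RHB matrix meet in a single nonzero entry
   n_k n_k' / n, in the column of the first row of block k'; the condition n_k >= m_k ensures that
   block k has a row for it on the diagonal of A12. Averaging the (k,k') block divides its total
   by n_k n_k' and gives 1/n. The first entry n_k^2/n - n_k + 1 makes the diagonal block
   (k,k) sum to n_k^2/n, so it is averaged to 1/n as well. A row therefore has at most one nonzero
   entry per block, and the first row of the last block attains this bound. The only possible
   cancellation is n (n_k - 1) = n_k^2, which forces n_k - 1 to divide 1, hence n_k = 2 and n = 4. *)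

theory Submission
  imports Defs
begin

section \<open>Nonzero counts of block matrices\<close>

definition row_nnz :: "real mat \<Rightarrow> nat \<Rightarrow> nat" where
  "row_nnz A i = card {j. j < dim_col A \<and> A $$ (i, j) \<noteq> 0}"

lemma d_max_eq_Max_row_nnz: "d_max A = Max (row_nnz A ` {..<dim_row A})"
  by (simp add: d_max_def row_nnz_def image_def)

text \<open>As a sum of indicators, a count splits at block borders by
  \<open>sum_lessThan_add\<close> and lets row and column sums be interchanged.\<close>

lemma row_nnz_eq_sum: "row_nnz A i = (\<Sum>j<dim_col A. of_bool (A $$ (i, j) \<noteq> 0))"
proof -
  have "{j. j < dim_col A \<and> A $$ (i, j) \<noteq> 0} = {..<dim_col A} \<inter> {j. A $$ (i, j) \<noteq> 0}"
    by auto
  then show ?thesis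
    by (simp add: row_nnz_def sum.inter_restrict flip: card_eq_sum)
qed

lemma nnz_eq_sum_row_nnz: "nnz A = (\<Sum>i<dim_row A. row_nnz A i)"
proof -
  have "{(i, j). i < dim_row A \<and> j < dim_col A \<and> A $$ (i, j) \<noteq> 0}
      = (SIGMA i:{..<dim_row A}. {j. j < dim_col A \<and> A $$ (i, j) \<noteq> 0})"
    by auto
  then show ?thesis
    by (simp add: nnz_def row_nnz_def card_SigmaI)
qed

lemma nnz_transpose_mat: "nnz (transpose_mat A) = nnz A"
proof -
  have "nnz (transpose_mat A) = (\<Sum>i<dim_col A. \<Sum>j<dim_row A. of_bool (A $$ (j, i) \<noteq> 0))"
    by (simp add: nnz_eq_sum_row_nnz row_nnz_eq_sum)
  also have "\<dots> = nnz A"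
    by (subst sum.swap) (simp add: nnz_eq_sum_row_nnz row_nnz_eq_sum)
  finally show ?thesis .
qed

lemma sum_lessThan_add:
  fixes f :: "nat \<Rightarrow> 'a::comm_monoid_add"
  shows "(\<Sum>i<a + b. f i) = (\<Sum>i<a. f i) + (\<Sum>i<b. f (a + i))"
  by (induction b) (simp_all add: add.assoc)

lemma row_nnz_four_block_mat:
  assumes "A \<in> carrier_mat a b" "B \<in> carrier_mat a d" "C \<in> carrier_mat c b" "D \<in> carrier_mat c d"
    and "i < a + c"
  shows "row_nnz (four_block_mat A B C D) i =
    (if i < a then row_nnz A i + row_nnz B i else row_nnz C (i - a) + row_nnz D (i - a))"
  using assms by (auto simp: row_nnz_eq_sum sum_lessThan_add intro!: arg_cong[where f = card])

lemma nnz_four_block_mat: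
  assumes "A \<in> carrier_mat a b" "B \<in> carrier_mat a d" "C \<in> carrier_mat c b" "D \<in> carrier_mat c d"
  shows "nnz (four_block_mat A B C D) = nnz A + nnz B + nnz C + nnz D"
  using assms row_nnz_four_block_mat[OF assms]
  by (simp add: nnz_eq_sum_row_nnz sum_lessThan_add sum.distrib)

lemma row_nnz_diagonal_mat:
  assumes "diagonal_mat A" "i < dim_row A"
  shows "row_nnz A i = of_bool (i < dim_col A \<and> A $$ (i, i) \<noteq> 0)"
proof -
  have "{j. j < dim_col A \<and> A $$ (i, j) \<noteq> 0}
      = (if i < dim_col A \<and> A $$ (i, i) \<noteq> 0 then {i} else {})"
    using assms by (auto simp: diagonal_mat_def)
  then show ?thesis
    by (simp add: row_nnz_def)
qed

lemma diagonal_mat_transpose: "diagonal_mat A \<Longrightarrow> diagonal_mat (transpose_mat A)"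
  by (auto simp: diagonal_mat_def)

text \<open>The final theorem reads its blocks off with \<open>split_block\<close>; this identifies
  them with the blocks used in the construction.\<close>

lemma split_block_four_block_mat:
  assumes "A \<in> carrier_mat a b" "B \<in> carrier_mat a d" "C \<in> carrier_mat c b" "D \<in> carrier_mat c d"
  shows "split_block (four_block_mat A B C D) a b = (A, B, C, D)"
  using assms by (auto simp: split_block_def Let_def intro!: eq_matI)


section \<open>Sandwiching by block averaging matrices\<close>

lemma index_mult_mat_sum:
  assumes "A \<in> carrier_mat a b" "B \<in> carrier_mat b c" "i < a" "j < c"
  shows "(A * B) $$ (i, j) = (\<Sum>r<b. A $$ (i, r) * B $$ (r, j))"
  using assms by (auto simp: scalar_prod_def atLeast0LessThan)

text \<open>The zero blocks remove all cross terms, so each block can be averaged on its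
  own.\<close>

lemma block_diagonal_sandwich:
  fixes X Y :: "'a::comm_ring_1 mat"
  assumes [simp]: "X \<in> carrier_mat a a" "Y \<in> carrier_mat c c" "A \<in> carrier_mat a a"
    "B \<in> carrier_mat a c" "C \<in> carrier_mat c a" "D \<in> carrier_mat c c"
  shows "four_block_mat X (0\<^sub>m a c) (0\<^sub>m c a) Y * four_block_mat A B C D *
      four_block_mat X (0\<^sub>m a c) (0\<^sub>m c a) Y
    = four_block_mat (X * A * X) (X * B * Y) (Y * C * X) (Y * D * Y)"
proof -
  note [simp] = assms[THEN carrier_matD(1)] assms[THEN carrier_matD(2)]
  have [simp]: "X * A \<in> carrier_mat a a" "X * B \<in> carrier_mat a c"
    "Y * C \<in> carrier_mat c a" "Y * D \<in> carrier_mat c c"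
    "X * A * X \<in> carrier_mat a a" "X * B * Y \<in> carrier_mat a c"
    "Y * C * X \<in> carrier_mat c a" "Y * D * Y \<in> carrier_mat c c"
    by (auto intro!: carrier_matI)
  have "four_block_mat X (0\<^sub>m a c) (0\<^sub>m c a) Y * four_block_mat A B C D
      = four_block_mat (X * A) (X * B) (Y * C) (Y * D)"
    by (subst mult_four_block_mat[where ?nr1.0 = a and ?n1.0 = a and ?n2.0 = c and ?nr2.0 = c
          and ?nc1.0 = a and ?nc2.0 = c]) simp_all
  then show ?thesis
    by (simp only:) (subst mult_four_block_mat[where ?nr1.0 = a and ?n1.0 = a and ?n2.0 = c
          and ?nr2.0 = c and ?nc1.0 = a and ?nc2.0 = c]; simp)
qed

lemma averaging_mat_carrier [simp]: "averaging_mat n \<in> carrier_mat n n"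
  by (simp add: averaging_mat_def)

lemma dim_averaging_mat [simp]:
  "dim_row (averaging_mat n) = n" "dim_col (averaging_mat n) = n"
  by (simp_all add: averaging_mat_def)

lemma transpose_averaging_mat [simp]: "transpose_mat (averaging_mat n) = averaging_mat n"
  by (auto simp: averaging_mat_def)

text \<open>Averaging on both sides replaces every entry by the mean of all a^2 entries; for a
  diagonal matrix their total is the trace.\<close>

lemma averaging_mat_diag_sandwich:
  "averaging_mat a * mat_diag a f * averaging_mat a = mat a a (\<lambda>_. (\<Sum>i<a. f i) / (real a)\<^sup>2)"
proof -
  have "averaging_mat a * mat_diag a f = mat a a (\<lambda>(i, j). f j / real a)"
    by (subst mat_diag_mult_right[of _ a a]) (auto simp: averaging_mat_def)
  then show ?thesis
    by (auto simp: averaging_mat_def scalar_prod_def atLeast0LessThan power2_eq_square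
        simp flip: sum_divide_distrib)
qed

lemma rhb_first_entry_eq_0:
  assumes "0 < a" "0 < n" "(real a)\<^sup>2 / real n - real a + 1 = 0"
  shows "n = 4 \<and> a = 2"
proof -
  obtain b where a: "a = Suc b"
    using assms(1) by (cases a) auto
  have "(real a)\<^sup>2 = real n * (real a - 1)"
    using assms(2,3) by (simp add: field_simps)
  then have "real (a\<^sup>2) = real (n * b)"
    by (simp add: a)
  then have eq: "a\<^sup>2 = n * b"
    by (simp only: of_nat_eq_iff)
  \<comment> \<open>(b + 1)^2 is written as a multiple of b plus 1, so that b must divide that
    1.\<close>
  have "b * (b + 2) + 1 = b * n"
    using eq by (simp add: a power2_eq_square algebra_simps)
  then have "b dvd 1"
    by (metis dvd_add_right_iff dvd_triv_left)
  then show ?thesis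
    using eq by (simp add: a power2_eq_square)
qed


section \<open>Partitions with dominating parts\<close>

locale hb_partition =
  fixes p :: "nat \<Rightarrow> nat" and \<tau> :: nat
  assumes tau_pos: "1 \<le> \<tau>"
    and part_pos: "1 \<le> k \<Longrightarrow> k \<le> \<tau> \<Longrightarrow> 0 < p k"
    and tail_le_part: "1 \<le> k \<Longrightarrow> k < \<tau> \<Longrightarrow> tail_size p \<tau> k \<le> p k"
begin

abbreviation m :: "nat \<Rightarrow> nat" where "m \<equiv> tail_size p \<tau>"

lemma tail_size_step: "k < \<tau> \<Longrightarrow> m k = p (Suc k) + m (Suc k)"
  by (simp add: tail_size_def sum.atLeast_Suc_atMost)

lemma tail_size_pred: "1 \<le> k \<Longrightarrow> k \<le> \<tau> \<Longrightarrow> m (k - 1) = p k + m k"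
  using tail_size_step[of "k - 1"] by simp

lemma tail_size_last [simp]: "m \<tau> = 0"
  by (simp add: tail_size_def)

lemma part_le_tail_size: "k < i \<Longrightarrow> i \<le> \<tau> \<Longrightarrow> p i \<le> m k"
  by (simp add: tail_size_def member_le_sum)

lemma total_pos: "0 < m 0"
  using tail_size_pred[OF _ tau_pos] part_le_tail_size[of 0 1] part_pos[of 1] tau_pos by simp

lemma offset_0 [simp]: "offset p k 0 = 0"
  by (simp add: offset_def)

text \<open>The sum is peeled at its first part, not its last, because \<open>rhb_seq\<close> splits
  off its leading block.\<close>

lemma offset_Suc: "offset p k (Suc l) = p (Suc k) + offset p (Suc k) l"
  by (induction l) (simp_all add: offset_def)

text \<open>With m_k seen as one further offset, strict monotonicity bounds all block starts by
  m_k.\<close>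

lemma tail_size_eq_offset: "k \<le> \<tau> \<Longrightarrow> m k = offset p k (\<tau> - k)"
proof -
  assume "k \<le> \<tau>"
  then have "m k = (\<Sum>i = 1 + k..(\<tau> - k) + k. p i)"
    by (simp add: tail_size_def)
  then show ?thesis
    unfolding sum.shift_bounds_cl_nat_ivl by (simp add: offset_def add.commute)
qed

lemma offset_strict_mono: "l < l' \<Longrightarrow> k + l' \<le> \<tau> \<Longrightarrow> offset p k l < offset p k l'"
proof (induction l')
  case (Suc l')
  have "offset p k l \<le> offset p k l'"
    using Suc by (cases "l = l'") auto
  moreover have "offset p k (Suc l') = offset p k l' + p (k + Suc l')"
    by (simp add: offset_def)
  ultimately show ?case
    using part_pos[of "k + Suc l'"] Suc.prems by simp
qed simp

lemma inj_on_offset: "inj_on (offset p k) {..<\<tau> - k}"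
proof (rule linorder_inj_onI)
  fix l l' assume "l < l'" "l \<in> {..<\<tau> - k}" "l' \<in> {..<\<tau> - k}"
  then show "offset p k l \<noteq> offset p k l'"
    using offset_strict_mono[of l l' k] by (simp add: less_diff_conv)
qed auto

lemma offset_less_tail_size: "l < \<tau> - k \<Longrightarrow> offset p k l < m k"
  using tail_size_eq_offset[of k] offset_strict_mono[of l "\<tau> - k" k] by simp

text \<open>The bound by m_k carries over to the rows through n_k \<ge> m_k; for k \<ge> \<tau>
  there is no \<open>l\<close> at all.\<close>

lemma offset_less_part: "1 \<le> k \<Longrightarrow> l < \<tau> - k \<Longrightarrow> offset p k l < p k"
  using offset_less_tail_size[of l k] tail_le_part[of k] by (cases "k < \<tau>") auto


section \<open>The blocks of the RHB matrix\<close>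

definition alpha :: "nat \<Rightarrow> real" where
  "alpha k = (real (p k))\<^sup>2 / real (m 0) - real (p k) + 1"

lemma rhb_11_eq: "rhb_11 p \<tau> k = mat_diag (p k) (\<lambda>i. if i = 0 then alpha k else 1)"
  unfolding rhb_11_def alpha_def ..

lemma rhb_11_carrier [simp]: "rhb_11 p \<tau> k \<in> carrier_mat (p k) (p k)"
  by (simp add: rhb_11_eq)

lemma dim_rhb_11 [simp]: "dim_row (rhb_11 p \<tau> k) = p k" "dim_col (rhb_11 p \<tau> k) = p k"
  using rhb_11_carrier[of k] by (simp_all del: rhb_11_carrier)

lemma diagonal_rhb_11 [simp]: "diagonal_mat (rhb_11 p \<tau> k)"
  by (simp add: rhb_11_eq mat_diag_def diagonal_mat_def)

lemma transpose_rhb_11 [simp]: "transpose_mat (rhb_11 p \<tau> k) = rhb_11 p \<tau> k"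
  by (auto simp: rhb_11_eq mat_diag_def)

lemma row_nnz_rhb_11:
  "i < p k \<Longrightarrow> row_nnz (rhb_11 p \<tau> k) i = of_bool (i = 0 \<longrightarrow> alpha k \<noteq> 0)"
  by (subst row_nnz_diagonal_mat) (simp, simp, simp add: rhb_11_eq mat_diag_def)

lemma nnz_rhb_11: "alpha k \<noteq> 0 \<Longrightarrow> nnz (rhb_11 p \<tau> k) = p k"
  by (simp add: nnz_eq_sum_row_nnz row_nnz_rhb_11)

lemma averaged_rhb_11:
  assumes "1 \<le> k" "k \<le> \<tau>"
  shows "averaging_mat (p k) * rhb_11 p \<tau> k * averaging_mat (p k)
    = mat (p k) (p k) (\<lambda>_. 1 / real (m 0))"
proof -
  obtain b where b: "p k = Suc b"
    using part_pos[OF assms] by (cases "p k") auto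
  \<comment> \<open>The trace is \<open>alpha k\<close> plus n_k - 1 ones, and
    \<open>alpha k\<close> is chosen to cancel these ones.\<close>
  have "(\<Sum>i<p k. if i = 0 then alpha k else 1) = (real (p k))\<^sup>2 / real (m 0)"
    unfolding alpha_def b sum.lessThan_Suc_shift by simp
  then show ?thesis
    using part_pos[OF assms] by (simp add: rhb_11_eq averaging_mat_diag_sandwich)
qed

lemma rhb_12_carrier [simp]: "rhb_12 p \<tau> k \<in> carrier_mat (p k) (m k)"
  by (simp add: rhb_12_def)

lemma dim_rhb_12 [simp]: "dim_row (rhb_12 p \<tau> k) = p k" "dim_col (rhb_12 p \<tau> k) = m k"
  by (simp_all add: rhb_12_def)

lemma diagonal_rhb_12 [simp]: "diagonal_mat (rhb_12 p \<tau> k)"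
  by (auto simp: rhb_12_def diagonal_mat_def)

text \<open>The definite description becomes a sum with at most one nonzero term, which can be
  interchanged with sums over rows and columns.\<close>
lemma rhb_12_index:
  assumes "i < p k" "j < m k"
  shows "rhb_12 p \<tau> k $$ (i, j) = (\<Sum>l<\<tau> - k. if i = offset p k l \<and> j = offset p k l
    then real (p k) * real (p (k + l + 1)) / real (m 0) else 0)"
proof (cases "\<exists>l<\<tau> - k. i = offset p k l \<and> j = offset p k l")
  case True
  then obtain l where l: "l < \<tau> - k" "i = offset p k l" "j = offset p k l"
    by blast
  have eq_iff: "offset p k l = offset p k l' \<longleftrightarrow> l = l'" if "l' < \<tau> - k" for l'
    using inj_on_eq_iff[OF inj_on_offset[of k]] l(1) that by simp
  have the: "(THE l'. l' < \<tau> - k \<and> j = offset p k l') = l"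
    using l eq_iff by (intro the_equality) metis+
  have "(\<Sum>l'<\<tau> - k. if i = offset p k l' \<and> j = offset p k l'
      then real (p k) * real (p (k + l' + 1)) / real (m 0) else 0)
    = (\<Sum>l'<\<tau> - k. if l = l' then real (p k) * real (p (k + l' + 1)) / real (m 0) else 0)"
    by (intro sum.cong) (auto simp: l eq_iff)
  also have "\<dots> = real (p k) * real (p (k + l + 1)) / real (m 0)"
    using l(1) by simp
  finally show ?thesis
    using assms True the by (simp add: rhb_12_def)
next
  case False
  then have "(\<Sum>l<\<tau> - k. if i = offset p k l \<and> j = offset p k l
    then real (p k) * real (p (k + l + 1)) / real (m 0) else 0) = 0"
    by (intro sum.neutral) auto
  with False assms show ?thesis
    by (auto simp: rhb_12_def)
qed

text \<open>All terms of the sum in \<open>rhb_12_index\<close> are nonnegative, so it vanishes only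
  if each term does; the selected terms are positive.\<close>

lemma rhb_12_diagonal_nonzero_iff:
  assumes "1 \<le> k" "j < p k" "j < m k"
  shows "rhb_12 p \<tau> k $$ (j, j) \<noteq> 0 \<longleftrightarrow> j \<in> offset p k ` {..<\<tau> - k}"
proof -
  define c where "c l = real (p k) * real (p (k + l + 1)) / real (m 0)" for l
  have c: "0 < c l" if "l < \<tau> - k" for l
    using that total_pos part_pos[of k] part_pos[of "k + l + 1"] assms by (auto simp: c_def)
  then have nonneg: "0 \<le> (if j = offset p k l then c l else 0)" if "l < \<tau> - k" for l
    using that by (simp add: less_imp_le)
  have "rhb_12 p \<tau> k $$ (j, j) = (\<Sum>l<\<tau> - k. if j = offset p k l then c l else 0)"
    using assms by (simp add: rhb_12_index c_def cong: if_cong)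
  also have "\<dots> = 0 \<longleftrightarrow> (\<forall>l\<in>{..<\<tau> - k}. (if j = offset p k l then c l else 0) = 0)"
    using nonneg by (intro sum_nonneg_eq_0_iff) auto
  finally have "rhb_12 p \<tau> k $$ (j, j) = 0 \<longleftrightarrow> (\<forall>l<\<tau> - k. j \<noteq> offset p k l)"
    using c by force
  then show ?thesis
    by auto
qed

lemma row_nnz_rhb_12:
  assumes "1 \<le> k" "i < p k"
  shows "row_nnz (rhb_12 p \<tau> k) i = of_bool (i \<in> offset p k ` {..<\<tau> - k})"
  using assms rhb_12_diagonal_nonzero_iff[of k i] offset_less_tail_size[of _ k]
  by (subst row_nnz_diagonal_mat) auto

lemma row_nnz_transpose_rhb_12:
  assumes "1 \<le> k" "i < m k"
  shows "row_nnz (transpose_mat (rhb_12 p \<tau> k)) i = of_bool (i \<in> offset p k ` {..<\<tau> - k})"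
  using assms rhb_12_diagonal_nonzero_iff[of k i] offset_less_part[of k]
  by (subst row_nnz_diagonal_mat) (auto simp: diagonal_mat_transpose)

text \<open>The \<tau> - k offsets are distinct and all index existing rows, and each contributes
  one nonzero entry.\<close>

lemma nnz_rhb_12:
  assumes "1 \<le> k"
  shows "nnz (rhb_12 p \<tau> k) = \<tau> - k"
proof -
  have "nnz (rhb_12 p \<tau> k) = (\<Sum>i<p k. of_bool (i \<in> offset p k ` {..<\<tau> - k}))"
    using assms by (simp add: nnz_eq_sum_row_nnz row_nnz_rhb_12)
  also have "\<dots> = card (offset p k ` {..<\<tau> - k})"
    using offset_less_part[OF assms] by (subst sum_of_bool_eq) (auto intro!: arg_cong[where f = card])
  also have "\<dots> = \<tau> - k"
    by (simp add: card_image inj_on_offset)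
  finally show ?thesis .
qed


section \<open>Recursion from the last block\<close>

text \<open>Downward induction from the single last block, following the recursion of
  \<open>rhb_seq\<close>.\<close>

lemma block_induct [consumes 2, case_names last step]:
  assumes "1 \<le> k" "k \<le> \<tau>"
    and "P \<tau>"
    and "\<And>k. 1 \<le> k \<Longrightarrow> k < \<tau> \<Longrightarrow> P (Suc k) \<Longrightarrow> P k"
  shows "P k"
  using assms(2,3)
  by (induction rule: inc_induct) (use assms(1,4) in auto)

lemma rhb_seq_last: "rhb_seq p \<tau> \<tau> = rhb_11 p \<tau> \<tau>"
  by (subst rhb_seq.simps) simp

lemma rhb_seq_step: "k < \<tau> \<Longrightarrow> rhb_seq p \<tau> k =
    four_block_mat (rhb_11 p \<tau> k) (rhb_12 p \<tau> k) (transpose_mat (rhb_12 p \<tau> k)) (rhb_seq p \<tau> (Suc k))"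
  by (subst rhb_seq.simps) simp

lemma rhb_seq_carrier:
  "1 \<le> k \<Longrightarrow> k \<le> \<tau> \<Longrightarrow> rhb_seq p \<tau> k \<in> carrier_mat (m (k - 1)) (m (k - 1))"
proof (induction k rule: block_induct)
  case last
  then show ?case
    using tail_size_pred[OF tau_pos] by (simp add: rhb_seq_last)
next
  case (step k)
  then show ?case
    using tail_size_pred[of k] by (simp add: rhb_seq_step)
qed

lemma rhb_seq_Suc_carrier:
  "k < \<tau> \<Longrightarrow> rhb_seq p \<tau> (Suc k) \<in> carrier_mat (m k) (m k)"
  using rhb_seq_carrier[of "Suc k"] by simp

lemma transpose_rhb_12_carrier [simp]: "transpose_mat (rhb_12 p \<tau> k) \<in> carrier_mat (m k) (p k)"
  by simp

lemma transpose_rhb_seq: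
  "1 \<le> k \<Longrightarrow> k \<le> \<tau> \<Longrightarrow> transpose_mat (rhb_seq p \<tau> k) = rhb_seq p \<tau> k"
proof (induction k rule: block_induct)
  case last
  show ?case
    by (simp add: rhb_seq_last)
next
  case (step k)
  then show ?case
    using transpose_four_block_mat[OF rhb_11_carrier rhb_12_carrier transpose_rhb_12_carrier
        rhb_seq_Suc_carrier]
    by (simp add: rhb_seq_step)
qed

lemma hb_sequence_rhb: "hb_sequence p \<tau> (rhb_mat p \<tau>) (rhb_seq p \<tau>)"
  unfolding hb_sequence_def
proof (intro conjI ballI)
  fix k assume "k \<in> {1..<\<tau>}"
  then show "\<exists>A11 A12. A11 \<in> carrier_mat (p k) (p k) \<and> diagonal_mat A11 \<and>
      A12 \<in> carrier_mat (p k) (m k) \<and> diagonal_mat A12 \<and>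
      rhb_seq p \<tau> k = four_block_mat A11 A12 (transpose_mat A12) (rhb_seq p \<tau> (k + 1))"
    by (intro exI[of _ "rhb_11 p \<tau> k"] exI[of _ "rhb_12 p \<tau> k"]) (simp add: rhb_seq_step)
qed (auto simp: rhb_seq_carrier[simplified] transpose_rhb_seq rhb_mat_def rhb_seq_last)

lemma rhb_seq_split_block:
  assumes "1 \<le> k" "k < \<tau>"
  shows "split_block (rhb_seq p \<tau> k) (p k) (p k)
    = (rhb_11 p \<tau> k, rhb_12 p \<tau> k, transpose_mat (rhb_12 p \<tau> k), rhb_seq p \<tau> (Suc k))"
  unfolding rhb_seq_step[OF assms(2)]
  by (rule split_block_four_block_mat[OF rhb_11_carrier rhb_12_carrier transpose_rhb_12_carrier
        rhb_seq_Suc_carrier[OF assms(2)]])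

section \<open>Nonzero counts and row degrees of the trailing matrices\<close>

lemma nnz_rhb_seq:
  assumes "1 \<le> k" "k \<le> \<tau>" and alpha: "\<And>k. 1 \<le> k \<Longrightarrow> k \<le> \<tau> \<Longrightarrow> alpha k \<noteq> 0"
  shows "nnz (rhb_seq p \<tau> k) = m (k - 1) + (\<tau> + 1 - k) * (\<tau> - k)"
  using assms(1,2)
proof (induction k rule: block_induct)
  case last
  then show ?case
    using tail_size_pred[OF tau_pos] tau_pos by (simp add: rhb_seq_last nnz_rhb_11 alpha)
next
  case (step k)
  \<comment> \<open>With \<tau> = k + d + 1 the truncated subtractions disappear, and the count
    reduces to 2(d + 1) + (d + 1)d = (d + 2)(d + 1).\<close>
  obtain d where d: "\<tau> = Suc (k + d)"
    using step by (metis less_iff_Suc_add)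
  have "nnz (rhb_seq p \<tau> k) = p k + 2 * (\<tau> - k) + nnz (rhb_seq p \<tau> (Suc k))"
    using step rhb_seq_Suc_carrier[of k]
    by (simp add: rhb_seq_step nnz_four_block_mat[where a = "p k" and b = "p k" and c = "m k" and d = "m k"]
        nnz_transpose_mat nnz_rhb_11 nnz_rhb_12 alpha)
  also have "\<dots> = p k + 2 * (\<tau> - k) + (m k + (\<tau> - k) * (\<tau> - Suc k))"
    using step by simp
  also have "\<dots> = m (k - 1) + (\<tau> + 1 - k) * (\<tau> - k)"
    using tail_size_pred[of k] step by (simp add: d algebra_simps)
  finally show ?case .
qed

text \<open>The value of \<open>alpha k\<close> is left open, so that degrees can be controlled even
  when some first entries vanish.\<close>

lemma row_nnz_rhb_seq_step:
  assumes "1 \<le> k" "k < \<tau>" "i < m (k - 1)"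
  shows "row_nnz (rhb_seq p \<tau> k) i =
    (if i < p k then of_bool (i = 0 \<longrightarrow> alpha k \<noteq> 0) + of_bool (i \<in> offset p k ` {..<\<tau> - k})
     else of_bool (i - p k \<in> offset p k ` {..<\<tau> - k}) + row_nnz (rhb_seq p \<tau> (Suc k)) (i - p k))"
proof -
  have "i < p k + m k"
    using assms tail_size_pred[of k] by simp
  moreover from this have "i - p k < m k" if "\<not> i < p k"
    using that by simp
  ultimately show ?thesis
    using assms(1,2)
    by (simp add: rhb_seq_step row_nnz_four_block_mat[OF rhb_11_carrier rhb_12_carrier
          transpose_rhb_12_carrier rhb_seq_Suc_carrier] row_nnz_rhb_11 row_nnz_rhb_12
        row_nnz_transpose_rhb_12)
qed

text \<open>A row of block k has at most two nonzeros, one in A11 and one in A12, which suffices as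
  k < \<tau>. A lower row gains at most one over the next trailing matrix.\<close>

lemma row_nnz_rhb_seq_le:
  "1 \<le> k \<Longrightarrow> k \<le> \<tau> \<Longrightarrow> i < m (k - 1) \<Longrightarrow> row_nnz (rhb_seq p \<tau> k) i \<le> \<tau> + 1 - k"
proof (induction k arbitrary: i rule: block_induct)
  case last
  then show ?case
    using tail_size_pred[OF tau_pos] by (simp add: rhb_seq_last row_nnz_rhb_11)
next
  case (step k)
  show ?case
  proof (cases "i < p k")
    case True
    then show ?thesis
      using step by (auto simp: row_nnz_rhb_seq_step of_bool_def Suc_diff_le)
  next
    case False
    then have "row_nnz (rhb_seq p \<tau> (Suc k)) (i - p k) \<le> \<tau> - k"
      using step.IH[of "i - p k"] step tail_size_pred[of k] by simp
    with False show ?thesis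
      using step by (simp add: row_nnz_rhb_seq_step of_bool_def Suc_diff_le)
  qed
qed

text \<open>The index is the first row of block \<tau> inside \<open>rhb_seq p \<tau> k\<close>.
  This row meets each earlier block in one nonzero entry, and its own diagonal entry is
  \<open>alpha \<tau>\<close>.\<close>

lemma row_nnz_rhb_seq_last_block:
  assumes "1 \<le> k" "k \<le> \<tau>" "alpha \<tau> \<noteq> 0"
  shows "row_nnz (rhb_seq p \<tau> k) (offset p (k - 1) (\<tau> - k)) = \<tau> + 1 - k"
  using assms(1,2)
proof (induction k rule: block_induct)
  case last
  then show ?case
    using part_pos[OF tau_pos] assms(3) by (simp add: rhb_seq_last row_nnz_rhb_11)
next
  case (step k)
  define l where "l = \<tau> - Suc k"
  have l: "\<tau> - k = Suc l" "l < \<tau> - k"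
    using step by (auto simp: l_def)
  have off: "offset p (k - 1) (\<tau> - k) = p k + offset p k l"
    using step l offset_Suc[of "k - 1" l] by simp
  moreover have "offset p k l < m k"
    using l offset_less_tail_size by blast
  ultimately have "row_nnz (rhb_seq p \<tau> k) (offset p (k - 1) (\<tau> - k))
      = of_bool (offset p k l \<in> offset p k ` {..<\<tau> - k}) + row_nnz (rhb_seq p \<tau> (Suc k)) (offset p k l)"
    using step tail_size_pred[of k] by (subst row_nnz_rhb_seq_step) auto
  \<comment> \<open>The first summand is 1 because \<open>l\<close> is the largest admissible index;
    the second is the induction hypothesis.\<close>
  also have "\<dots> = 1 + (\<tau> - k)"
    using step.IH l by (auto simp: l_def)
  finally show ?case
    using step by simp
qed

lemma d_max_rhb_mat:
  assumes "alpha \<tau> \<noteq> 0"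
  shows "d_max (rhb_mat p \<tau>) = \<tau>"
proof -
  have dim: "dim_row (rhb_mat p \<tau>) = m 0"
    using rhb_seq_carrier[OF _ tau_pos] by (simp add: rhb_mat_def)
  have "offset p 0 (\<tau> - 1) < m 0"
    using tau_pos by (intro offset_less_tail_size) simp
  then have "\<tau> \<in> row_nnz (rhb_mat p \<tau>) ` {..<m 0}"
    using row_nnz_rhb_seq_last_block[OF _ tau_pos assms]
    by (intro image_eqI[of _ _ "offset p 0 (\<tau> - 1)"]) (auto simp: rhb_mat_def)
  then show ?thesis
    unfolding d_max_eq_Max_row_nnz dim
    using row_nnz_rhb_seq_le[OF _ tau_pos] by (intro Max_eqI) (auto simp: rhb_mat_def)
qed

section \<open>Averaging, with J_0 generalised to its trailing blocks to permit induction\<close>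

definition tail_averaging_mat :: "nat \<Rightarrow> real mat" where
  "tail_averaging_mat k = diag_block_mat (map (\<lambda>i. averaging_mat (p i)) [k..<\<tau> + 1])"

lemma tail_averaging_mat_carrier:
  "1 \<le> k \<Longrightarrow> tail_averaging_mat k \<in> carrier_mat (m (k - 1)) (m (k - 1))"
  by (auto simp: tail_averaging_mat_def dim_diag_block_mat o_def tail_size_def
      sum_list_distinct_conv_sum_set atLeastLessThanSuc_atLeastAtMost
      intro!: carrier_matI simp del: upt_Suc)

lemma tail_averaging_mat_step:
  assumes "k \<le> \<tau>"
  shows "tail_averaging_mat k = four_block_mat (averaging_mat (p k)) (0\<^sub>m (p k) (m k))
    (0\<^sub>m (m k) (p k)) (tail_averaging_mat (Suc k))"
proof -
  have "[k..<\<tau> + 1] = k # [Suc k..<\<tau> + 1]"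
    using assms by (simp add: upt_conv_Cons del: upt_Suc)
  then show ?thesis
    using tail_averaging_mat_carrier[of "Suc k"]
    by (simp add: tail_averaging_mat_def Let_def del: upt_Suc)
qed

lemma transpose_tail_averaging_mat:
  assumes "1 \<le> k" "k \<le> \<tau>"
  shows "transpose_mat (tail_averaging_mat k) = tail_averaging_mat k"
proof -
  \<comment> \<open>This step also serves k = \<tau>, starting from the empty matrix at
    \<open>Suc \<tau>\<close>.\<close>
  have tr: "transpose_mat (tail_averaging_mat k) = tail_averaging_mat k"
    if "transpose_mat (tail_averaging_mat (Suc k)) = tail_averaging_mat (Suc k)" "k \<le> \<tau>" for k
    using that tail_averaging_mat_carrier[of "Suc k"]
    by (simp add: tail_averaging_mat_step transpose_four_block_mat[where ?nr1.0 = "p k"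
          and ?nr2.0 = "m k" and ?nc1.0 = "p k" and ?nc2.0 = "m k"])
  have "transpose_mat (tail_averaging_mat (Suc \<tau>)) = tail_averaging_mat (Suc \<tau>)"
    by (simp add: tail_averaging_mat_def)
  with assms show ?thesis
    by (induction k rule: block_induct) (auto intro: tr)
qed

text \<open>Column \<open>j\<close> lies in exactly one block \<open>k + l\<close>, and only there the first row of the block has
  a nonzero entry, namely \<open>1 / p (k + l)\<close>.\<close>
lemma weighted_first_rows:
  assumes "1 \<le> k" "k \<le> \<tau>" "j < m (k - 1)"
  shows "(\<Sum>l<\<tau> + 1 - k. real (p (k + l)) * tail_averaging_mat k $$ (offset p (k - 1) l, j)) = 1"
  using assms
proof (induction k arbitrary: j rule: block_induct)
  case last
  then show ?case
    using tail_size_pred[OF tau_pos] part_pos[OF tau_pos]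
    by (simp add: tail_averaging_mat_def averaging_mat_def)
next
  case (step k)
  have carr: "tail_averaging_mat (Suc k) \<in> carrier_mat (m k) (m k)"
    using tail_averaging_mat_carrier[of "Suc k"] by simp
  have j: "j < p k + m k"
    using step tail_size_pred[of k] by simp
  \<comment> \<open>The term l = 0 belongs to block k and accounts for all columns of that
    block.\<close>
  have first: "tail_averaging_mat k $$ (0, j) = (if j < p k then 1 / real (p k) else 0)"
    using step carr j part_pos[of k]
    by (auto simp: tail_averaging_mat_step[of k] averaging_mat_def)
  \<comment> \<open>By \<open>offset_Suc\<close> the later block starts are those of the next
    trailing matrix, shifted by \<open>p k\<close>.\<close>
  have rest: "tail_averaging_mat k $$ (offset p (k - 1) (Suc l), j)
      = (if j < p k then 0 else tail_averaging_mat (Suc k) $$ (offset p k l, j - p k))"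
    if "l < \<tau> - k" for l
    using step carr j that offset_less_tail_size[OF that] offset_Suc[of "k - 1" l]
    by (auto simp: tail_averaging_mat_step[of k])
  have "(\<Sum>l<\<tau> + 1 - k. real (p (k + l)) * tail_averaging_mat k $$ (offset p (k - 1) l, j))
      = real (p k) * tail_averaging_mat k $$ (0, j)
        + (\<Sum>l<\<tau> - k. real (p (Suc k + l)) * tail_averaging_mat k $$ (offset p (k - 1) (Suc l), j))"
    using step by (simp add: Suc_diff_le sum.lessThan_Suc_shift del: sum.lessThan_Suc)
  also have "\<dots> = (if j < p k then 1 else \<Sum>l<\<tau> + 1 - Suc k.
      real (p (Suc k + l)) * tail_averaging_mat (Suc k) $$ (offset p (Suc k - 1) l, j - p k))"
    using step part_pos[of k] by (simp add: first rest del: One_nat_def)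
  also have "\<dots> = 1"
    using step.IH[of "j - p k"] j by auto
  finally show ?case .
qed

text \<open>Left averaging spreads each nonzero entry of A12 evenly over its column, leaving
  n_{k+l+1}/n. Right multiplication then combines the first rows of the trailing blocks with these
  weights, and \<open>weighted_first_rows\<close> evaluates the combination.\<close>

lemma averaged_rhb_12:
  assumes "1 \<le> k" "k < \<tau>"
  shows "averaging_mat (p k) * rhb_12 p \<tau> k * tail_averaging_mat (Suc k)
    = mat (p k) (m k) (\<lambda>_. 1 / real (m 0))"
proof (rule eq_matI, goal_cases)
  case (1 i j)
  then have ij: "i < p k" "j < m k"
    by auto
  let ?Y = "tail_averaging_mat (Suc k)"
  let ?c = "\<lambda>l. real (p (k + l + 1)) / real (m 0)"
  have Y: "?Y \<in> carrier_mat (m k) (m k)"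
    using tail_averaging_mat_carrier[of "Suc k"] by simp
  have col: "(averaging_mat (p k) * rhb_12 p \<tau> k) $$ (i, r)
      = (\<Sum>l<\<tau> - k. if r = offset p k l then ?c l else 0)" if "r < m k" for r
  proof -
    have "(averaging_mat (p k) * rhb_12 p \<tau> k) $$ (i, r)
        = (\<Sum>s<p k. 1 / real (p k) * rhb_12 p \<tau> k $$ (s, r))"
      using ij that
      by (subst index_mult_mat_sum[OF averaging_mat_carrier rhb_12_carrier])
        (auto simp: averaging_mat_def)
    \<comment> \<open>The two conditions are nested so that, after the sums are swapped, the sum
      over \<open>s\<close> collapses to the row \<open>offset p k l\<close>, which exists by
      \<open>offset_less_part\<close>.\<close>
    also have "\<dots> = (\<Sum>s<p k. \<Sum>l<\<tau> - k.
        if s = offset p k l then if r = offset p k l then ?c l else 0 else 0)"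
      using that part_pos[of k] assms
      by (intro sum.cong refl) (auto simp: rhb_12_index sum_distrib_left intro!: sum.cong)
    also have "\<dots> = (\<Sum>l<\<tau> - k. if r = offset p k l then ?c l else 0)"
      using offset_less_part[OF assms(1)] by (subst sum.swap) simp
    finally show ?thesis .
  qed
  have "(averaging_mat (p k) * rhb_12 p \<tau> k * ?Y) $$ (i, j)
      = (\<Sum>r<m k. (\<Sum>l<\<tau> - k. if r = offset p k l then ?c l else 0) * ?Y $$ (r, j))"
    using ij Y by (subst index_mult_mat_sum[where a = "p k" and b = "m k" and c = "m k"])
      (auto simp: col simp del: index_mult_mat intro!: mult_carrier_mat)
  also have "\<dots> = (\<Sum>r<m k. \<Sum>l<\<tau> - k. if r = offset p k l then ?c l * ?Y $$ (r, j) else 0)"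
    by (auto simp: sum_distrib_right intro!: sum.cong)
  also have "\<dots> = (\<Sum>l<\<tau> - k. ?c l * ?Y $$ (offset p k l, j))"
    using offset_less_tail_size[of _ k] by (subst sum.swap) simp
  \<comment> \<open>Only a reindexing, to match \<open>weighted_first_rows\<close> at
    \<open>Suc k\<close>.\<close>
  also have "\<dots> = (\<Sum>l<\<tau> + 1 - Suc k. real (p (Suc k + l)) * ?Y $$ (offset p (Suc k - 1) l, j)) / real (m 0)"
    by (simp add: sum_divide_distrib)
  also have "\<dots> = 1 / real (m 0)"
    using weighted_first_rows[of "Suc k" j] assms ij by simp
  finally show ?case
    using ij by simp
qed (use tail_averaging_mat_carrier[of "Suc k"] in auto)

text \<open>Each of the four blocks averages to the same constant. This constant involves the full
  size \<open>m 0\<close> for every k, so the induction passes it on unchanged.\<close>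

lemma averaged_rhb_seq:
  "1 \<le> k \<Longrightarrow> k \<le> \<tau> \<Longrightarrow> tail_averaging_mat k * rhb_seq p \<tau> k * tail_averaging_mat k
    = mat (m (k - 1)) (m (k - 1)) (\<lambda>_. 1 / real (m 0))"
proof (induction k rule: block_induct)
  case last
  have "tail_averaging_mat \<tau> = averaging_mat (p \<tau>)"
    by (auto simp: tail_averaging_mat_def)
  then show ?case
    using averaged_rhb_11[OF tau_pos] tail_size_pred[OF tau_pos] by (simp add: rhb_seq_last)
next
  case (step k)
  let ?X = "averaging_mat (p k)" and ?Y = "tail_averaging_mat (Suc k)" and ?B = "rhb_12 p \<tau> k"
  have Y: "?Y \<in> carrier_mat (m k) (m k)" "transpose_mat ?Y = ?Y"
    using tail_averaging_mat_carrier[of "Suc k"] transpose_tail_averaging_mat[of "Suc k"] step by auto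
  have XB: "?X * ?B \<in> carrier_mat (p k) (m k)"
    by (auto intro!: mult_carrier_mat)
  \<comment> \<open>The lower left block is the transpose of the upper right one, since both
    averaging factors are symmetric.\<close>
  have "?Y * transpose_mat ?B * ?X = ?Y * (transpose_mat ?B * ?X)"
    using Y by (intro assoc_mult_mat) auto
  also have "\<dots> = transpose_mat (?X * ?B * ?Y)"
    using transpose_mult[OF XB Y(1)] transpose_mult[OF averaging_mat_carrier rhb_12_carrier, of k] Y(2)
    by simp
  also have "\<dots> = mat (m k) (p k) (\<lambda>_. 1 / real (m 0))"
    using step by (auto simp: averaged_rhb_12)
  finally have YBX: "?Y * transpose_mat ?B * ?X = mat (m k) (p k) (\<lambda>_. 1 / real (m 0))" .
  have "tail_averaging_mat k * rhb_seq p \<tau> k * tail_averaging_mat k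
      = four_block_mat (?X * rhb_11 p \<tau> k * ?X) (?X * ?B * ?Y) (?Y * transpose_mat ?B * ?X)
          (?Y * rhb_seq p \<tau> (Suc k) * ?Y)"
    using step Y(1) rhb_seq_Suc_carrier[of k]
    by (simp add: tail_averaging_mat_step rhb_seq_step block_diagonal_sandwich)
  also have "\<dots> = mat (m (k - 1)) (m (k - 1)) (\<lambda>_. 1 / real (m 0))"
    using step tail_size_pred[of k] by (auto simp: YBX averaged_rhb_11 averaged_rhb_12)
  finally show ?case .
qed

lemma averaging_mat_factorization:
  "averaging_mat (m 0) = block_averaging_mat p \<tau> * rhb_mat p \<tau> * block_averaging_mat p \<tau>"
  using averaged_rhb_seq[OF _ tau_pos]
  by (simp add: rhb_mat_def block_averaging_mat_def tail_averaging_mat_def averaging_mat_def)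

text \<open>The dominance condition forces p_1 = 2 even when the vanishing entry lies in a later
  block. The clause for k = \<tau> serves \<open>d_max_rhb_mat\<close>, which asks only for
  \<open>alpha \<tau> \<noteq> 0\<close>.\<close>

lemma alpha_eq_0:
  assumes "1 \<le> k" "k \<le> \<tau>" "alpha k = 0"
  shows "m 0 = 4 \<and> p 1 = 2 \<and> (k = \<tau> \<longrightarrow> \<tau> = 2)"
proof -
  have n: "m 0 = 4" "p k = 2"
    using rhb_first_entry_eq_0[OF part_pos[OF assms(1,2)] total_pos] assms(3)
    by (auto simp: alpha_def)
  have step: "m 0 = p 1 + m 1"
    using tail_size_step[of 0] tau_pos by simp
  show ?thesis
  proof (cases "k = 1")
    case True
    \<comment> \<open>Here \<tau> = 1 would give n = p_1 = 2 instead of 4.\<close>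
    with n step show ?thesis
      using part_le_tail_size[of 1 2] tail_size_last by (cases "\<tau> = 1") auto
  next
    case False
    \<comment> \<open>Since p_1 + m_1 = 4 and p_1 \<ge> m_1 \<ge> p_k = 2, both equal 2. If k > 2,
      then p_2 \<ge> 1 would give m_1 \<ge> 3, so k = 2.\<close>
    then have "p k \<le> m 1" "m 1 \<le> p 1" "m 1 = p 2 + m 2"
      using assms part_le_tail_size[of 1 k] tail_le_part[of 1] tail_size_step[of 1]
      by (auto simp: numeral_2_eq_2)
    moreover have "p 2 > 0" "2 < k \<Longrightarrow> p k \<le> m 2"
      using assms False part_le_tail_size[of 2 k] part_pos[of 2] by auto
    ultimately show ?thesis
      using n step False assms by (cases "2 < k") auto
  qed
qed

end

text \<open>The case n = 4, p_1 = 2 consists of 4 = 2 + 2 and 4 = 2 + 1 + 1, where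
  \<open>alpha 1\<close> vanishes and nonzeros are lost. For 2 + 1 + 1 the last block still has a
  nonzero first entry, so the degree claim excludes only 2 + 2.\<close>

theorem theorem1:
  fixes n \<tau> :: nat and p :: "nat \<Rightarrow> nat"
  assumes n_ge: "n \<ge> 2"
    and partition: "n = (\<Sum>k = 1..\<tau>. p k)"
    and p_pos: "\<And>k. k \<in> {1..\<tau>} \<Longrightarrow> p k \<ge> 1"
    and p_ge_tail: "\<And>k. k \<in> {1..<\<tau>} \<Longrightarrow> p k \<ge> tail_size p \<tau> k"
  shows "rhb_mat p \<tau> \<in> carrier_mat n n \<and>
         hierarchically_banded p \<tau> (rhb_mat p \<tau>) \<and>
         hb_sequence p \<tau> (rhb_mat p \<tau>) (rhb_seq p \<tau>) \<and>
         averaging_mat n = block_averaging_mat p \<tau> * rhb_mat p \<tau> * block_averaging_mat p \<tau> \<and>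
         (\<forall>k\<in>{1..<\<tau>}.
           case split_block (rhb_seq p \<tau> k) (p k) (p k) of (A11, A12, A21, A22) \<Rightarrow>
             offset p k ` {..<\<tau> - k} \<subseteq> {..<min (dim_row A12) (dim_col A12)} \<and>
             (\<forall>j<min (dim_row A12) (dim_col A12).
                A12 $$ (j, j) \<noteq> 0 \<longleftrightarrow> j \<in> offset p k ` {..<\<tau> - k}) \<and>
             (\<exists>\<alpha>. A11 = mat_diag (p k) (\<lambda>i. if i = 0 then \<alpha> else 1))) \<and>
         (\<not> (n = 4 \<and> p 1 = 2) \<longrightarrow> nnz (rhb_mat p \<tau>) = n + \<tau> * (\<tau> - 1)) \<and>
         (\<not> (n = 4 \<and> p 1 = 2 \<and> \<tau> = 2) \<longrightarrow> d_max (rhb_mat p \<tau>) = \<tau>)"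
proof -
  have "1 \<le> \<tau>"
    using n_ge partition by (cases \<tau>) auto
  then interpret hb_partition p \<tau>
    using p_pos p_ge_tail by unfold_locales (auto simp: Suc_le_eq)
  have n: "n = m 0"
    using partition by (simp add: tail_size_def)
  have blocks: "case split_block (rhb_seq p \<tau> k) (p k) (p k) of (A11, A12, A21, A22) \<Rightarrow>
      offset p k ` {..<\<tau> - k} \<subseteq> {..<min (dim_row A12) (dim_col A12)} \<and>
      (\<forall>j<min (dim_row A12) (dim_col A12).
        A12 $$ (j, j) \<noteq> 0 \<longleftrightarrow> j \<in> offset p k ` {..<\<tau> - k}) \<and>
      (\<exists>\<alpha>. A11 = mat_diag (p k) (\<lambda>i. if i = 0 then \<alpha> else 1))"
    if "k \<in> {1..<\<tau>}" for k
    using that offset_less_part[of k] offset_less_tail_size[of _ k]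
    by (auto simp: rhb_seq_split_block rhb_12_diagonal_nonzero_iff rhb_11_eq)
  have "nnz (rhb_mat p \<tau>) = n + \<tau> * (\<tau> - 1)" if "\<not> (n = 4 \<and> p 1 = 2)"
    using nnz_rhb_seq[OF _ tau_pos] alpha_eq_0 that n by (auto simp: rhb_mat_def)
  moreover have "d_max (rhb_mat p \<tau>) = \<tau>" if "\<not> (n = 4 \<and> p 1 = 2 \<and> \<tau> = 2)"
    using d_max_rhb_mat alpha_eq_0[OF tau_pos] that n by auto
  moreover have "rhb_mat p \<tau> \<in> carrier_mat n n"
    using rhb_seq_carrier[OF _ tau_pos] n by (simp add: rhb_mat_def)
  moreover have "averaging_mat n = block_averaging_mat p \<tau> * rhb_mat p \<tau> * block_averaging_mat p \<tau>"
    using averaging_mat_factorization n by simp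
  moreover have "hierarchically_banded p \<tau> (rhb_mat p \<tau>)"
    using hb_sequence_rhb by (auto simp: hierarchically_banded_def)
  ultimately show ?thesis
    by (intro conjI impI ballI hb_sequence_rhb blocks)
qed

end
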